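(* The Grothendieck constant of order five satisfies $K_G(5)\geq 1.49339$; consequently, $K_G(d)\geq 1.49339$ for every integer $d\geq 5$.
   Context: For a positive integer $d$, let $S^{d-1}=\{v\in\mathbb{R}^d : \|v\|=1\}$ be the Euclidean unit sphere (so $S^0=\{-1,1\}$). For a real matrix $M$ of size $m_1\times m_2$ define $$\mathrm{SDP}_d(M)=\max\Big\{\sum_{x=1}^{m_1}\sum_{y=1}^{m_2}M_{xy}\langle a_x,b_y\rangle : a_1,\dots,a_{m_1},b_1,\dots,b_{m_2}\in S^{d-1}\Big\}.$$ The Grothendieck constant of order $d$ is $$K_G(d)=\sup\Big\{\frac{\mathrm{SDP}_d(M)}{\mathrm{SDP}_1(M)} : m_1,m_2\in\mathbb{N},\ M\in\mathbb{R}^{m_1\times m_2},\ M\neq 0\Big\},$$ i.e. the smallest constant $K$ such that $\mathrm{SDP}_d(M)\leq K\,\mathrm{SDP}_1(M)$ for all real matrices $M$ of all sizes. *)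

theory Defs
  imports Complex_Main "Jordan_Normal_Form.Matrix"
begin

text \<open>
  Vectors and matrices have explicit dimensions, because the dimension \<^term>\<open>d\<close> of the sphere
  and the format of the matrix are quantified over. Indices start from 0.
\<close>

definition vnorm :: "real vec \<Rightarrow> real" where
  "vnorm v = sqrt (v \<bullet> v)"

text \<open>\<open>unit_sphere d\<close> is $S^{d-1}$, the unit sphere of the \<^term>\<open>d\<close>-dimensional Euclidean space.\<close>

definition unit_sphere :: "nat \<Rightarrow> real vec set" where
  "unit_sphere d = {v \<in> carrier_vec d. vnorm v = 1}"

definition sdp_values :: "nat \<Rightarrow> real mat \<Rightarrow> real set" where
  "sdp_values d M =
     {\<Sum>x<dim_row M. \<Sum>y<dim_col M. M $$ (x, y) * (a x \<bullet> b y) | a b.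
        (\<forall>x<dim_row M. a x \<in> unit_sphere d) \<and> (\<forall>y<dim_col M. b y \<in> unit_sphere d)}"

text \<open>
  For \<open>d > 0\<close> the maximum exists by compactness, so it is the supremum. The lemmas
  below show that neither this \<^const>\<open>Sup\<close> nor the one in \<open>K_G\<close> is taken of an empty or
  unbounded set, and that the quotients in \<open>K_G\<close> have positive denominators.
\<close>

definition SDP :: "nat \<Rightarrow> real mat \<Rightarrow> real" where
  "SDP d M = Sup (sdp_values d M)"

definition grothendieck_ratios :: "nat \<Rightarrow> real set" where
  "grothendieck_ratios d =
     {SDP d M / SDP 1 M | m1 m2 M. M \<in> carrier_mat m1 m2 \<and> M \<noteq> 0\<^sub>m m1 m2}"

definition K_G :: "nat \<Rightarrow> real" where
  "K_G d = Sup (grothendieck_ratios d)"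


lemma unit_sphere_coord_le:
  assumes "v \<in> unit_sphere d" "i < d"
  shows "\<bar>v $ i\<bar> \<le> 1"
proof -
  have "(\<Sum>j<d. v $ j * v $ j) = 1"
    using assms by (auto simp: unit_sphere_def vnorm_def scalar_prod_def atLeast0LessThan)
  moreover have "v $ i * v $ i \<le> (\<Sum>j<d. v $ j * v $ j)"
    by (rule member_le_sum) (use assms in auto)
  ultimately show ?thesis
    by (simp add: abs_square_le_1 flip: power2_eq_square)
qed

lemma unit_vec_in_unit_sphere: "d > 0 \<Longrightarrow> unit_vec d 0 \<in> unit_sphere d"
  by (simp add: unit_sphere_def vnorm_def)

lemma sdp_valuesI:
  assumes "\<And>x. x < dim_row M \<Longrightarrow> a x \<in> unit_sphere d"
    and "\<And>y. y < dim_col M \<Longrightarrow> b y \<in> unit_sphere d"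
  shows "(\<Sum>x<dim_row M. \<Sum>y<dim_col M. M $$ (x, y) * (a x \<bullet> b y)) \<in> sdp_values d M"
  unfolding sdp_values_def mem_Collect_eq using assms by (intro exI conjI refl) auto

lemma sdp_valuesE:
  assumes "s \<in> sdp_values d M"
  obtains a b where "s = (\<Sum>x<dim_row M. \<Sum>y<dim_col M. M $$ (x, y) * (a x \<bullet> b y))"
    and "\<forall>x<dim_row M. a x \<in> unit_sphere d" "\<forall>y<dim_col M. b y \<in> unit_sphere d"
  using assms unfolding sdp_values_def mem_Collect_eq by (elim exE conjE) (rule that)

lemma sdp_values_nonempty: "d > 0 \<Longrightarrow> sdp_values d M \<noteq> {}"
  using sdp_valuesI[of M "\<lambda>_. unit_vec d 0" d "\<lambda>_. unit_vec d 0"] unit_vec_in_unit_sphere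
  by (metis empty_iff)

lemma abs_scalar_prod_unit_le:
  assumes "v \<in> unit_sphere d" "w \<in> unit_sphere d"
  shows "\<bar>v \<bullet> w\<bar> \<le> real d"
proof -
  have "\<bar>v \<bullet> w\<bar> \<le> (\<Sum>i<d. \<bar>v $ i * w $ i\<bar>)"
    using assms by (auto simp: unit_sphere_def scalar_prod_def atLeast0LessThan)
  also have "\<dots> \<le> (\<Sum>i<d. 1)"
  proof (rule sum_mono)
    fix i assume "i \<in> {..<d}"
    then have "\<bar>v $ i\<bar> \<le> 1" "\<bar>w $ i\<bar> \<le> 1"
      using assms unit_sphere_coord_le by simp_all
    then show "\<bar>v $ i * w $ i\<bar> \<le> 1"
      by (simp add: abs_mult mult_le_one)
  qed
  finally show ?thesis by simp
qed

lemma sdp_values_bdd_above: "bdd_above (sdp_values d M)"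
proof (rule bdd_aboveI)
  fix s assume "s \<in> sdp_values d M"
  then obtain a b where s: "s = (\<Sum>x<dim_row M. \<Sum>y<dim_col M. M $$ (x, y) * (a x \<bullet> b y))"
    and ab: "\<forall>x<dim_row M. a x \<in> unit_sphere d" "\<forall>y<dim_col M. b y \<in> unit_sphere d"
    by (rule sdp_valuesE)
  have "M $$ (x, y) * (a x \<bullet> b y) \<le> \<bar>M $$ (x, y)\<bar> * real d"
    if "x < dim_row M" "y < dim_col M" for x y
  proof -
    have "M $$ (x, y) * (a x \<bullet> b y) \<le> \<bar>M $$ (x, y)\<bar> * \<bar>a x \<bullet> b y\<bar>"
      by (metis abs_ge_self abs_mult)
    also have "\<dots> \<le> \<bar>M $$ (x, y)\<bar> * real d"
      using ab that by (intro mult_left_mono abs_scalar_prod_unit_le) auto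
    finally show ?thesis .
  qed
  then show "s \<le> (\<Sum>x<dim_row M. \<Sum>y<dim_col M. \<bar>M $$ (x, y)\<bar> * real d)"
    unfolding s by (intro sum_mono) auto
qed

lemma sign_form_le_SDP_1:
  fixes M :: "real mat"
  assumes "\<And>x. s x \<in> {-1, 1}" "\<And>y. t y \<in> {-1, 1}"
  shows "(\<Sum>x<dim_row M. \<Sum>y<dim_col M. M $$ (x, y) * (s x * t y)) \<le> SDP 1 M"
  unfolding SDP_def
proof (rule cSup_upper[OF _ sdp_values_bdd_above])
  have s: "vec 1 (\<lambda>_. s x) \<in> unit_sphere 1" for x
    using assms(1)[of x] by (auto simp: unit_sphere_def vnorm_def scalar_prod_def)
  have t: "vec 1 (\<lambda>_. t x) \<in> unit_sphere 1" for x
    using assms(2)[of x] by (auto simp: unit_sphere_def vnorm_def scalar_prod_def)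
  have "(\<Sum>x<dim_row M. \<Sum>y<dim_col M. M $$ (x, y) * (s x * t y)) =
    (\<Sum>x<dim_row M. \<Sum>y<dim_col M. M $$ (x, y) * (vec 1 (\<lambda>_. s x) \<bullet> vec 1 (\<lambda>_. t y)))"
    by (simp add: scalar_prod_def)
  then show "(\<Sum>x<dim_row M. \<Sum>y<dim_col M. M $$ (x, y) * (s x * t y)) \<in> sdp_values 1 M"
    using sdp_valuesI[of M "\<lambda>x. vec 1 (\<lambda>_. s x)" 1 "\<lambda>y. vec 1 (\<lambda>_. t y)"] s t by simp
qed

lemma cube_form_le_SDP_1:
  fixes M :: "real mat" and u v :: "nat \<Rightarrow> real"
  assumes u: "\<And>x. x < dim_row M \<Longrightarrow> \<bar>u x\<bar> \<le> 1" and v: "\<And>y. y < dim_col M \<Longrightarrow> \<bar>v y\<bar> \<le> 1"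
  shows "(\<Sum>x<dim_row M. \<Sum>y<dim_col M. M $$ (x, y) * (u x * v y)) \<le> SDP 1 M"
proof -
  have sign: "r * c \<le> (if c \<ge> 0 then 1 else -1) * c" if "\<bar>r\<bar> \<le> 1" for r c :: real
  proof -
    have "r * c \<le> \<bar>r\<bar> * \<bar>c\<bar>" by (metis abs_ge_self abs_mult)
    also have "\<dots> \<le> \<bar>c\<bar>" using mult_right_mono[OF that, of "\<bar>c\<bar>"] by simp
    finally show ?thesis by auto
  qed
  define s :: "nat \<Rightarrow> real" where "s x = (if (\<Sum>y<dim_col M. M $$ (x, y) * v y) \<ge> 0 then 1 else -1)" for x
  define t :: "nat \<Rightarrow> real" where "t y = (if (\<Sum>x<dim_row M. M $$ (x, y) * s x) \<ge> 0 then 1 else -1)" for y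
  have "(\<Sum>x<dim_row M. \<Sum>y<dim_col M. M $$ (x, y) * (u x * v y)) =
      (\<Sum>x<dim_row M. u x * (\<Sum>y<dim_col M. M $$ (x, y) * v y))"
    by (simp add: sum_distrib_left mult_ac)
  also have "\<dots> \<le> (\<Sum>x<dim_row M. s x * (\<Sum>y<dim_col M. M $$ (x, y) * v y))"
    unfolding s_def by (intro sum_mono sign u) auto
  also have "\<dots> = (\<Sum>x<dim_row M. \<Sum>y<dim_col M. v y * (M $$ (x, y) * s x))"
    by (simp add: sum_distrib_left mult_ac)
  also have "\<dots> = (\<Sum>y<dim_col M. v y * (\<Sum>x<dim_row M. M $$ (x, y) * s x))"
    by (subst sum.swap) (simp add: sum_distrib_left)
  also have "\<dots> \<le> (\<Sum>y<dim_col M. t y * (\<Sum>x<dim_row M. M $$ (x, y) * s x))"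
    unfolding t_def by (intro sum_mono sign v) auto
  also have "\<dots> = (\<Sum>y<dim_col M. \<Sum>x<dim_row M. M $$ (x, y) * (s x * t y))"
    by (simp add: sum_distrib_left mult_ac)
  also have "\<dots> = (\<Sum>x<dim_row M. \<Sum>y<dim_col M. M $$ (x, y) * (s x * t y))"
    by (rule sum.swap)
  also have "\<dots> \<le> SDP 1 M"
    by (rule sign_form_le_SDP_1) (auto simp: s_def t_def)
  finally show ?thesis .
qed

lemma SDP_1_pos:
  assumes "M \<in> carrier_mat m1 m2" "M \<noteq> 0\<^sub>m m1 m2"
  shows "SDP 1 M > 0"
proof -
  obtain p q where pq: "p < dim_row M" "q < dim_col M" "M $$ (p, q) \<noteq> 0"
    using assms by (metis eq_matI carrier_matD index_zero_mat)
  let ?u = "\<lambda>x. if x = p then sgn (M $$ (p, q)) else 0"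
  let ?v = "\<lambda>y. if y = q then 1 else (0::real)"
  have "(\<Sum>x<dim_row M. \<Sum>y<dim_col M. M $$ (x, y) * (?u x * ?v y)) =
      (\<Sum>x<dim_row M. if x = p then \<bar>M $$ (p, q)\<bar> else 0)"
    using pq by (intro sum.cong) (auto simp: if_distrib[of "\<lambda>z. _ * z"] abs_sgn cong: if_cong)
  also have "\<dots> = \<bar>M $$ (p, q)\<bar>" using pq by simp
  finally have "(\<Sum>x<dim_row M. \<Sum>y<dim_col M. M $$ (x, y) * (?u x * ?v y)) = \<bar>M $$ (p, q)\<bar>" .
  moreover have "(\<Sum>x<dim_row M. \<Sum>y<dim_col M. M $$ (x, y) * (?u x * ?v y)) \<le> SDP 1 M"
    by (rule cube_form_le_SDP_1) (auto simp: sgn_real_def)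
  ultimately show ?thesis using pq(3) by linarith
qed

lemma SDP_le_dim_mult_SDP_1:
  assumes "d > 0"
  shows "SDP d M \<le> real d * SDP 1 M"
proof -
  have "s \<le> real d * SDP 1 M" if mem: "s \<in> sdp_values d M" for s
  proof -
    obtain a b where s: "s = (\<Sum>x<dim_row M. \<Sum>y<dim_col M. M $$ (x, y) * (a x \<bullet> b y))"
      and ab: "\<forall>x<dim_row M. a x \<in> unit_sphere d" "\<forall>y<dim_col M. b y \<in> unit_sphere d"
      using mem by (rule sdp_valuesE)
    have "s = (\<Sum>x<dim_row M. \<Sum>y<dim_col M. \<Sum>i<d. M $$ (x, y) * (a x $ i * b y $ i))"
      unfolding s using ab
      by (intro sum.cong)
        (auto simp: scalar_prod_def unit_sphere_def atLeast0LessThan sum_distrib_left)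
    also have "\<dots> = (\<Sum>x<dim_row M. \<Sum>i<d. \<Sum>y<dim_col M. M $$ (x, y) * (a x $ i * b y $ i))"
      by (intro sum.cong refl sum.swap)
    also have "\<dots> = (\<Sum>i<d. \<Sum>x<dim_row M. \<Sum>y<dim_col M. M $$ (x, y) * (a x $ i * b y $ i))"
      by (rule sum.swap)
    also have "\<dots> \<le> (\<Sum>i<d. SDP 1 M)"
      by (intro sum_mono cube_form_le_SDP_1) (use ab unit_sphere_coord_le in auto)
    finally show ?thesis by simp
  qed
  then show ?thesis
    unfolding SDP_def[of d] by (intro cSup_least sdp_values_nonempty assms)
qed

lemma grothendieck_ratios_bdd_above: "d > 0 \<Longrightarrow> bdd_above (grothendieck_ratios d)"
  unfolding grothendieck_ratios_def
  by (rule bdd_aboveI[of _ "real d"])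
    (auto simp: pos_divide_le_eq[OF SDP_1_pos] SDP_le_dim_mult_SDP_1 simp del: One_nat_def)

lemma grothendieck_ratios_nonempty: "grothendieck_ratios d \<noteq> {}"
proof -
  have "(1\<^sub>m 1 :: real mat) $$ (0, 0) \<noteq> 0\<^sub>m 1 1 $$ (0, 0)" by simp
  then have "(1\<^sub>m 1 :: real mat) \<noteq> 0\<^sub>m 1 1" by metis
  then show ?thesis
    unfolding grothendieck_ratios_def using one_carrier_mat by blast
qed

lemma SDP_zero: "d > 0 \<Longrightarrow> SDP d (0\<^sub>m m1 m2) = 0"
proof -
  assume "d > 0"
  moreover have "sdp_values d (0\<^sub>m m1 m2) \<subseteq> {0}"
    by (auto simp: sdp_values_def)
  ultimately have "sdp_values d (0\<^sub>m m1 m2) = {0}"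
    using sdp_values_nonempty by blast
  then show ?thesis by (simp add: SDP_def)
qed

lemma K_G_le_iff:
  assumes "d > 0"
  shows "K_G d \<le> K \<longleftrightarrow> (\<forall>M. SDP d M \<le> K * SDP 1 M)"
proof -
  have "K_G d \<le> K \<longleftrightarrow> (\<forall>r \<in> grothendieck_ratios d. r \<le> K)"
    unfolding K_G_def
    by (rule cSup_le_iff[OF grothendieck_ratios_nonempty grothendieck_ratios_bdd_above[OF assms]])
  also have "\<dots> \<longleftrightarrow> (\<forall>m1 m2. \<forall>M \<in> carrier_mat m1 m2. M \<noteq> 0\<^sub>m m1 m2 \<longrightarrow> SDP d M \<le> K * SDP 1 M)"
    unfolding grothendieck_ratios_def
    by (simp only: Ball_def mem_Collect_eq) (metis pos_divide_le_eq SDP_1_pos)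
  also have "\<dots> \<longleftrightarrow> (\<forall>M. SDP d M \<le> K * SDP 1 M)"
  proof (intro iffI allI ballI impI)
    fix M
    assume *: "\<forall>m1 m2. \<forall>M \<in> carrier_mat m1 m2. M \<noteq> 0\<^sub>m m1 m2 \<longrightarrow> SDP d M \<le> K * SDP 1 M"
    show "SDP d M \<le> K * SDP 1 M"
    proof (cases "M = 0\<^sub>m (dim_row M) (dim_col M)")
      case True
      then have "SDP n M = 0" if "n > 0" for n
        using SDP_zero[OF that] by metis
      then show ?thesis using assms by simp
    next
      case False
      then show ?thesis using * by blast
    qed
  qed blast
  finally show ?thesis .
qed

end

(*
  For a measure mu on the sphere S^4, consider the Davie-Reeds form <x, y> - kappa * delta(x, y).
  Choosing both families of vectors equal to the points themselves gives at least 1/5 - kappa, by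
  Cauchy-Schwarz applied to the second moment matrix of mu, whose trace is 1.
  For sign functions f and g, let A be the set where they agree, m its measure, and U the integral
  of f(x) x over A, in direction e and of length s. The form takes a value of at most
  s^2 + kappa - 2 kappa m, while s <= E(|<x, e>| - t)_+ + t m for every t. Taking t = kappa / s
  eliminates m, and leaves 2 s E(|<x, e>| - kappa/s)_+ - s^2 + kappa.
  For the uniform measure, E(|<x, e>| - t)_+ <= 3/8 - t + 3/4 t^2; with kappa = 1/25 the form on signs
  is at most 0.1071..., so that the ratio is above 0.16 / 0.10713 > 1.49339.
  A matrix is obtained from a sufficiently fine finite partition of the sphere. The uniform
  measure is realized by Lebesgue measure on the unit ball, through the directions z / |z|.
*)
theory Submission
  imports Defs "HOL-Analysis.Analysis"
begin

section \<open>Transport of Lebesgue measure along a bijection of bases\<close>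

lemma inner_basis_map:
  fixes \<beta> :: "'a::euclidean_space \<Rightarrow> 'b::euclidean_space"
  assumes "bij_betw \<beta> Basis Basis" "b \<in> Basis"
  shows "inner (\<Sum>b\<in>Basis. inner z b *\<^sub>R \<beta> b) (\<beta> b) = inner z b"
proof -
  have "inner (\<Sum>b\<in>Basis. inner z b *\<^sub>R \<beta> b) (\<beta> b) = (\<Sum>c\<in>Basis. inner z c * inner (\<beta> c) (\<beta> b))"
    by (simp add: inner_sum_left)
  also have "\<dots> = (\<Sum>c\<in>Basis. inner z c * (if c = b then 1 else 0))"
  proof (intro sum.cong refl)
    fix c assume "c \<in> (Basis :: 'a set)"
    then have "\<beta> c \<in> Basis" "\<beta> b \<in> Basis" "\<beta> c = \<beta> b \<longleftrightarrow> c = b"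
      using assms by (auto simp: bij_betw_def inj_on_def)
    then show "inner z c * inner (\<beta> c) (\<beta> b) = inner z c * (if c = b then 1 else 0)"
      by (simp add: inner_Basis)
  qed
  also have "\<dots> = inner z b" using assms by (simp add: mult_delta_right)
  finally show ?thesis .
qed

text \<open>Renaming basis vectors pulls a box back to a box with the same side lengths, and
  Lebesgue measure is determined by its values on boxes. This links
  \<open>real \<times> (real^4)\<close>, where Fubini applies, with \<open>real^5\<close>.\<close>

lemma lborel_distr_basis_bij:
  fixes \<beta> :: "'a::euclidean_space \<Rightarrow> 'b::euclidean_space"
  assumes \<beta>: "bij_betw \<beta> Basis Basis"
  defines "\<phi> \<equiv> (\<lambda>z. \<Sum>b\<in>Basis. inner z b *\<^sub>R \<beta> b)"
  shows "distr lborel borel \<phi> = lborel"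
proof (rule lborel_eqI[symmetric])
  have [measurable]: "\<phi> \<in> borel_measurable borel" unfolding \<phi>_def by measurable
  have inner_\<phi>: "inner (\<phi> z) (\<beta> b) = inner z b" if "b \<in> Basis" for z b
    unfolding \<phi>_def by (rule inner_basis_map[OF \<beta> that])
  fix l u :: 'b
  assume le: "\<And>b. b \<in> Basis \<Longrightarrow> inner l b \<le> inner u b"
  define p where "p x = (\<Sum>b\<in>Basis. inner x (\<beta> b) *\<^sub>R b)" for x
  have p: "inner (p x) b = inner x (\<beta> b)" if "b \<in> Basis" for x b
    using that by (simp add: p_def inner_sum_left inner_Basis if_distrib cong: if_cong)
  have Ball: "(\<forall>c\<in>Basis. P c) \<longleftrightarrow> (\<forall>b\<in>Basis. P (\<beta> b))" for P
    using \<beta> by (metis bij_betw_def image_iff)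
  have "\<phi> -` box l u = box (p l) (p u)"
    by (simp add: box_def Ball inner_\<phi> p set_eq_iff)
  then have "emeasure (distr lborel borel \<phi>) (box l u) = emeasure lborel (box (p l) (p u))"
    by (simp add: emeasure_distr)
  also have "\<dots> = (\<Prod>b\<in>Basis. inner (p u - p l) b)"
    using le \<beta> by (intro emeasure_lborel_box) (auto simp: p bij_betw_def)
  also have "(\<Prod>b\<in>Basis. inner (p u - p l) b) = (\<Prod>b\<in>Basis. inner (u - l) (\<beta> b))"
    by (intro prod.cong refl) (simp add: p inner_diff_left)
  also have "\<dots> = (\<Prod>b\<in>Basis. inner (u - l) b)"
    by (rule prod.reindex_bij_betw[OF \<beta>])
  finally show "emeasure (distr lborel borel \<phi>) (box l u) = (\<Prod>b\<in>Basis. inner (u - l) b)" .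
qed auto

section \<open>Volumes of cones over spherical caps\<close>

text \<open>The cone over the open spherical cap of directions x with \<open>inner x e > s\<close>,
  cut with the unit ball. Multiplying by the norm avoids a division, and the strict inequality
  excludes the origin.\<close>

definition cap_cone :: "'a::euclidean_space \<Rightarrow> real \<Rightarrow> 'a set" where
  "cap_cone e s = {z. s * norm z < inner z e \<and> norm z \<le> 1}"

lemma cap_cone_measurable [measurable]: "cap_cone e s \<in> sets borel"
  unfolding cap_cone_def by measurable

text \<open>Fubini in the first coordinate, with pi^2/2 r^4 as the volume of a four-dimensional
  ball. The heights below s contribute s (1 - s^2)^2 / 5 and those above s contribute 8/15 - s + 2/3
  s^3 - s^5/5, both times pi^2/2; the fifth powers cancel in the sum.\<close>

lemma emeasure_cap_cone_prod:
  assumes s: "0 < s" "s \<le> 1"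
  shows "emeasure lborel (cap_cone (1, 0) s :: (real \<times> (real^4)) set)
    \<le> ennreal (pi\<^sup>2 / 2 * (8/15 - 4/5 * s + 4/15 * s^3))"
proof -
  \<comment> \<open>The slice at height \<open>x\<close> lies in a four-dimensional ball, whose radius is dictated by the cone for
    \<open>x \<le> s\<close> and by the unit ball for \<open>x \<ge> s\<close>.\<close>
  define h where "h x = ennreal (pi\<^sup>2 / 2 * ((1/s\<^sup>2 - 1)\<^sup>2 * x^4)) * indicator {0..s} x
      + ennreal (pi\<^sup>2 / 2 * (1 - x\<^sup>2)\<^sup>2) * indicator {s..1} x" for x :: real
  have "emeasure lborel (cap_cone (1, 0) s :: (real \<times> (real^4)) set)
     = emeasure (lborel \<Otimes>\<^sub>M lborel) (cap_cone (1, 0) s :: (real \<times> (real^4)) set)"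
    by (simp add: lborel_prod)
  also have "\<dots> = (\<integral>\<^sup>+ x. emeasure lborel (Pair x -` (cap_cone (1, 0) s :: (real \<times> (real^4)) set)) \<partial>lborel)"
    by (intro lborel.emeasure_pair_measure_alt) (simp only: lborel_prod, simp)
  also have "\<dots> \<le> (\<integral>\<^sup>+ x. h x \<partial>lborel)"
  proof (intro nn_integral_mono)
    fix x :: real
    have vol: "emeasure lborel (cball (0::real^4) r) = ennreal (pi\<^sup>2 / 2 * r^4)" if "r \<ge> 0" for r
      using that by (simp add: emeasure_cball eval_unit_ball_vol)
    have sqrt_pow4: "sqrt c ^ 4 = c\<^sup>2" if "c \<ge> 0" for c
      using power_mult[of "sqrt c" 2 2] that by simp
    have mem: "y \<in> Pair x -` cap_cone (1, 0) s \<longleftrightarrow> s * sqrt (x\<^sup>2 + (norm y)\<^sup>2) < x \<and> x\<^sup>2 + (norm y)\<^sup>2 \<le> 1" for y :: "real^4"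
      by (simp add: cap_cone_def norm_Pair inner_prod_def)
    show "emeasure lborel (Pair x -` (cap_cone (1, 0) s :: (real \<times> (real^4)) set)) \<le> h x"
    proof (cases "0 \<le> x \<and> x \<le> 1")
      case False
      have "Pair x -` (cap_cone (1, 0) s :: (real \<times> (real^4)) set) = {}"
      proof (rule equals0I)
        fix y :: "real^4"
        assume "y \<in> Pair x -` cap_cone (1, 0) s"
        then have *: "s * sqrt (x\<^sup>2 + (norm y)\<^sup>2) < x" "x\<^sup>2 + (norm y)\<^sup>2 \<le> 1"
          unfolding mem by auto
        have "x \<ge> 0" using *(1) s by (smt (verit) mult_nonneg_nonneg real_sqrt_ge_zero sum_power2_ge_zero)
        moreover have "x\<^sup>2 \<le> 1" using *(2) by (smt (verit) zero_le_power2)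
        ultimately show False using False by (simp add: abs_square_le_1)
      qed
      then show ?thesis by simp
    next
      case True
      show ?thesis
      proof (cases "x \<le> s")
        case True
        have s2: "1 / s\<^sup>2 - 1 \<ge> 0" using s by (simp add: power_le_one)
        have "Pair x -` cap_cone (1, 0) s \<subseteq> cball (0::real^4) (sqrt (1/s\<^sup>2 - 1) * x)"
        proof (rule subsetI)
          fix y :: "real^4"
          assume "y \<in> Pair x -` cap_cone (1, 0) s"
          then have *: "s * sqrt (x\<^sup>2 + (norm y)\<^sup>2) < x" "x\<^sup>2 + (norm y)\<^sup>2 \<le> 1"
            unfolding mem by auto
          have "(s * sqrt (x\<^sup>2 + (norm y)\<^sup>2))\<^sup>2 \<le> x\<^sup>2"
            using * s by (intro power_mono) auto
          then have "s\<^sup>2 * (x\<^sup>2 + (norm y)\<^sup>2) \<le> x\<^sup>2" by (simp add: power_mult_distrib)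
          then have "(norm y)\<^sup>2 \<le> (1/s\<^sup>2 - 1) * x\<^sup>2" using s by (simp add: field_simps)
          also have "\<dots> = (sqrt (1/s\<^sup>2 - 1) * x)\<^sup>2" using s2 by (simp add: power_mult_distrib)
          finally show "y \<in> cball 0 (sqrt (1/s\<^sup>2 - 1) * x)"
            using \<open>0 \<le> x \<and> x \<le> 1\<close> s2 power2_le_imp_le[of "norm y" "sqrt (1/s\<^sup>2 - 1) * x"]
            by (simp only: mem_cball_0) simp
        qed
        then have "emeasure lborel (Pair x -` cap_cone (1, 0) s :: (real^4) set) \<le> emeasure lborel (cball (0::real^4) (sqrt (1/s\<^sup>2 - 1) * x))"
          by (intro emeasure_mono) auto
        also have "\<dots> = ennreal (pi\<^sup>2 / 2 * (sqrt (1/s\<^sup>2 - 1) * x)^4)"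
          using \<open>0 \<le> x \<and> x \<le> 1\<close> s2 by (intro vol) auto
        also have "(sqrt (1/s\<^sup>2 - 1) * x)^4 = (1/s\<^sup>2 - 1)\<^sup>2 * x^4"
          using s2 by (simp only: power_mult_distrib sqrt_pow4)
        also have "ennreal (pi\<^sup>2 / 2 * ((1/s\<^sup>2 - 1)\<^sup>2 * x^4)) \<le> h x"
          unfolding h_def using True \<open>0 \<le> x \<and> x \<le> 1\<close> by (simp add: indicator_def)
        finally show ?thesis .
      next
        case False
        have x2: "1 - x\<^sup>2 \<ge> 0" using \<open>0 \<le> x \<and> x \<le> 1\<close> by (simp add: power_le_one)
        have "Pair x -` cap_cone (1, 0) s \<subseteq> cball (0::real^4) (sqrt (1 - x\<^sup>2))"
        proof (rule subsetI)
          fix y :: "real^4"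
          assume "y \<in> Pair x -` cap_cone (1, 0) s"
          then have *: "s * sqrt (x\<^sup>2 + (norm y)\<^sup>2) < x" "x\<^sup>2 + (norm y)\<^sup>2 \<le> 1"
            unfolding mem by auto
          from *(2) show "y \<in> cball 0 (sqrt (1 - x\<^sup>2))"
            by (simp add: real_le_rsqrt)
        qed
        then have "emeasure lborel (Pair x -` cap_cone (1, 0) s :: (real^4) set) \<le> emeasure lborel (cball (0::real^4) (sqrt (1 - x\<^sup>2)))"
          by (intro emeasure_mono) auto
        also have "\<dots> = ennreal (pi\<^sup>2 / 2 * (sqrt (1 - x\<^sup>2))^4)"
          using x2 by (intro vol) auto
        also have "(sqrt (1 - x\<^sup>2))^4 = (1 - x\<^sup>2)\<^sup>2"
          using x2 by (simp only: sqrt_pow4)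
        also have "ennreal (pi\<^sup>2 / 2 * (1 - x\<^sup>2)\<^sup>2) \<le> h x"
          unfolding h_def using False \<open>0 \<le> x \<and> x \<le> 1\<close> by (simp add: indicator_def)
        finally show ?thesis .
      qed
    qed
  qed
  also have "\<dots> = (\<integral>\<^sup>+ x. ennreal (pi\<^sup>2 / 2 * ((1/s\<^sup>2 - 1)\<^sup>2 * x^4)) * indicator {0..s} x \<partial>lborel)
      + (\<integral>\<^sup>+ x. ennreal (pi\<^sup>2 / 2 * (1 - x\<^sup>2)\<^sup>2) * indicator {s..1} x \<partial>lborel)"
    unfolding h_def by (intro nn_integral_add) measurable
  also have "(\<integral>\<^sup>+ x. ennreal (pi\<^sup>2 / 2 * ((1/s\<^sup>2 - 1)\<^sup>2 * x^4)) * indicator {0..s} x \<partial>lborel)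
     = pi\<^sup>2 / 2 * ((1/s\<^sup>2 - 1)\<^sup>2 * s^5 / 5) - pi\<^sup>2 / 2 * ((1/s\<^sup>2 - 1)\<^sup>2 * 0^5 / 5)"
    using s by (intro nn_integral_FTC_Icc[where F = "\<lambda>x. pi\<^sup>2 / 2 * ((1/s\<^sup>2 - 1)\<^sup>2 * x^5 / 5)"])
      (auto intro!: derivative_eq_intros simp: field_simps)
  also have "(\<integral>\<^sup>+ x. ennreal (pi\<^sup>2 / 2 * (1 - x\<^sup>2)\<^sup>2) * indicator {s..1} x \<partial>lborel)
     = pi\<^sup>2 / 2 * (1 - 2 * 1^3 / 3 + 1^5 / 5) - pi\<^sup>2 / 2 * (s - 2 * s^3 / 3 + s^5/5)"
  proof (rule nn_integral_FTC_Icc[where F = "\<lambda>x. pi\<^sup>2 / 2 * (x - 2 * x^3 / 3 + x^5 / 5)"])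
    show "((\<lambda>x. pi\<^sup>2 / 2 * (x - 2 * x^3 / 3 + x^5 / 5)) has_real_derivative pi\<^sup>2 / 2 * (1 - x\<^sup>2)\<^sup>2) (at x)" for x
      by (auto intro!: derivative_eq_intros simp: algebra_simps power2_eq_square power4_eq_xxxx)
  qed (use s in auto)
  also have "ennreal (pi\<^sup>2 / 2 * ((1/s\<^sup>2 - 1)\<^sup>2 * s^5 / 5) - pi\<^sup>2 / 2 * ((1/s\<^sup>2 - 1)\<^sup>2 * 0^5 / 5))
     + ennreal (pi\<^sup>2 / 2 * (1 - 2 * 1^3 / 3 + 1^5 / 5) - pi\<^sup>2 / 2 * (s - 2 * s^3 / 3 + s^5/5))
     = ennreal ((pi\<^sup>2 / 2 * ((1/s\<^sup>2 - 1)\<^sup>2 * s^5 / 5) - pi\<^sup>2 / 2 * ((1/s\<^sup>2 - 1)\<^sup>2 * 0^5 / 5)) +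
       (pi\<^sup>2 / 2 * (1 - 2 * 1^3 / 3 + 1^5 / 5) - pi\<^sup>2 / 2 * (s - 2 * s^3 / 3 + s^5/5)))"
  proof (rule ennreal_plus[symmetric])
    show "0 \<le> pi\<^sup>2 / 2 * ((1/s\<^sup>2 - 1)\<^sup>2 * s^5 / 5) - pi\<^sup>2 / 2 * ((1/s\<^sup>2 - 1)\<^sup>2 * 0^5 / 5)"
      using s by simp
    \<comment> \<open>The left side is the integral of (1 - x^2)^2 from s to 1, so it vanishes to
      third order at s = 1. The factorization exhibits the sign that \<open>ennreal_plus\<close>
      requires.\<close>
    have "1 - 2 * 1^3 / 3 + 1^5 / 5 - (s - 2 * s^3 / 3 + s^5/5) = (1 - s)^3 * (8 + 9 * s + 3 * s\<^sup>2) / 15"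
      by (simp add: field_simps power2_eq_square power3_eq_cube power4_eq_xxxx eval_nat_numeral)
    also have "\<dots> \<ge> 0" using s by simp
    finally have "0 \<le> pi\<^sup>2 / 2 * (1 - 2 * 1^3 / 3 + 1^5 / 5 - (s - 2 * s^3 / 3 + s^5/5))"
      by simp
    then show "0 \<le> pi\<^sup>2 / 2 * (1 - 2 * 1^3 / 3 + 1^5 / 5) - pi\<^sup>2 / 2 * (s - 2 * s^3 / 3 + s^5/5)"
      by (simp only: right_diff_distrib)
  qed
  also have "(pi\<^sup>2 / 2 * ((1/s\<^sup>2 - 1)\<^sup>2 * s^5 / 5) - pi\<^sup>2 / 2 * ((1/s\<^sup>2 - 1)\<^sup>2 * 0^5 / 5)) +
       (pi\<^sup>2 / 2 * (1 - 2 * 1^3 / 3 + 1^5 / 5) - pi\<^sup>2 / 2 * (s - 2 * s^3 / 3 + s^5/5))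
     = pi\<^sup>2 / 2 * (8/15 - 4/5 * s + 4/15 * s^3)"
  proof -
    have "(1/s\<^sup>2 - 1)\<^sup>2 * s^5 = s * (1 - s\<^sup>2)\<^sup>2"
      using s by (simp add: field_simps eval_nat_numeral)
    then show ?thesis by (simp add: field_simps eval_nat_numeral)
  qed
  finally show ?thesis .
qed

text \<open>The axis of a cone must go to the axis of its image, so one value of the bijection is
  fixed in advance; the remaining basis vectors are matched by cardinality.\<close>

lemma bij_betw_Basis_prescribed:
  fixes b :: "'a::euclidean_space" and c :: "'b::euclidean_space"
  assumes dim: "DIM('a) = DIM('b)" and b: "b \<in> Basis" and c: "c \<in> Basis"
  obtains \<beta> :: "'a \<Rightarrow> 'b" where "bij_betw \<beta> Basis Basis" "\<beta> b = c"
proof -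
  have "card (Basis - {b}) = card (Basis - {c})"
    using assms by (simp add: card_Diff_singleton)
  then obtain g where g: "bij_betw g (Basis - {b}) (Basis - {c})"
    using finite_same_card_bij[of "Basis - {b}" "Basis - {c}"] by auto
  have "bij_betw (g(b := c)) (Basis - {b}) (Basis - {c})"
    using g by (subst bij_betw_cong[of _ _ g]) auto
  then have "bij_betw (g(b := c)) (insert b (Basis - {b})) (insert c (Basis - {c}))"
    using notIn_Un_bij_betw[of b "Basis - {b}" "g(b := c)" "Basis - {c}"] by simp
  then have "bij_betw (g(b := c)) Basis Basis"
    using b c by (simp add: insert_absorb)
  then show thesis by (rule that) simp
qed

text \<open>The map \<open>\<phi>\<close> preserves volume and norms and turns the coordinate along
  \<open>axis k 1\<close> into the first coordinate of the product, so the preimage of the cone is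
  the cone already measured.\<close>

lemma emeasure_cap_cone_axis:
  assumes s: "0 < s" "s \<le> 1"
  shows "emeasure lborel (cap_cone (axis k 1) s :: (real^5) set)
    \<le> ennreal (pi\<^sup>2 / 2 * (8/15 - 4/5 * s + 4/15 * s^3))"
proof -
  have "(1, 0) \<in> (Basis :: (real \<times> (real^4)) set)" by (simp add: Basis_prod_def)
  moreover have "axis k 1 \<in> (Basis :: (real^5) set)" by (simp add: axis_in_Basis_iff)
  moreover have "DIM(real \<times> (real^4)) = DIM(real^5)" by simp
  ultimately obtain \<beta> :: "real \<times> (real^4) \<Rightarrow> real^5"
    where \<beta>: "bij_betw \<beta> Basis Basis" "\<beta> (1, 0) = axis k 1"
    by (metis bij_betw_Basis_prescribed)
  define \<phi> where "\<phi> = (\<lambda>z. \<Sum>b\<in>Basis. inner z b *\<^sub>R \<beta> b)"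
  have [measurable]: "\<phi> \<in> borel_measurable borel" unfolding \<phi>_def by measurable
  have inner_\<phi>: "inner (\<phi> z) (\<beta> b) = inner z b" if "b \<in> Basis" for z b
    unfolding \<phi>_def by (rule inner_basis_map[OF \<beta>(1) that])
  have "inner (\<phi> z) (\<phi> z) = inner z z" for z
  proof -
    have "inner (\<phi> z) (\<phi> z) = (\<Sum>b\<in>Basis. inner z b * inner (\<phi> z) (\<beta> b))"
      by (subst (2) \<phi>_def) (simp add: inner_sum_right)
    also have "\<dots> = (\<Sum>b\<in>Basis. inner z b * inner z b)"
      by (intro sum.cong refl) (simp add: inner_\<phi>)
    finally show ?thesis by (simp flip: euclidean_inner)
  qed
  then have norm_\<phi>: "norm (\<phi> z) = norm z" for z by (simp add: norm_eq_sqrt_inner)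
  have inner_axis: "inner (\<phi> z) (axis k 1) = inner z (1, 0)" for z
    using inner_\<phi>[of "(1, 0)" z] \<beta>(2) by (simp add: Basis_prod_def)
  have "emeasure lborel (cap_cone (axis k 1) s :: (real^5) set) =
     emeasure (distr lborel borel \<phi>) (cap_cone (axis k 1) s)"
    unfolding \<phi>_def by (simp add: lborel_distr_basis_bij[OF \<beta>(1)])
  also have "\<dots> = emeasure lborel (\<phi> -` cap_cone (axis k 1) s)"
    by (simp add: emeasure_distr)
  also have "\<phi> -` cap_cone (axis k 1) s = cap_cone (1, 0) s"
    by (simp add: cap_cone_def vimage_def norm_\<phi> inner_axis)
  finally show ?thesis using emeasure_cap_cone_prod[OF s] by simp
qed

text \<open>By rotation invariance an arbitrary direction reduces to a coordinate axis: a rotation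
  taking the axis to \<open>e\<close> maps one cone onto the other.\<close>

lemma emeasure_cap_cone:
  fixes e :: "real^5"
  assumes s: "0 < s" "s \<le> 1" and e: "norm e = 1"
  shows "emeasure lborel (cap_cone e s) \<le> ennreal (pi\<^sup>2 / 2 * (8/15 - 4/5 * s + 4/15 * s^3))"
proof -
  obtain T where T: "orthogonal_transformation T" "T (axis 1 1 :: real^5) = e"
    using orthogonal_transformation_exists_1[of "axis 1 1 :: real^5" e] e by auto
  have inner_T: "inner (T w) e = inner w (axis 1 1)" for w
    using T by (metis orthogonal_transformation_def)
  have norm_T: "norm (T w) = norm w" for w
    using T(1) by (rule orthogonal_transformation_norm)
  have "z \<in> cap_cone e s" if "z \<in> T ` cap_cone (axis 1 1) s" for z
    using that inner_T norm_T by (auto simp: cap_cone_def)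
  moreover have "z \<in> T ` cap_cone (axis 1 1) s" if "z \<in> cap_cone e s" for z
  proof -
    obtain w where w: "z = T w" using T(1) by (metis orthogonal_transformation_surj surjD)
    then have "w \<in> cap_cone (axis 1 1) s"
      using that by (simp add: cap_cone_def inner_T norm_T)
    then show ?thesis using w by simp
  qed
  ultimately have eq: "cap_cone e s = T ` cap_cone (axis 1 1) s" by blast
  have bdd: "bounded (cap_cone f s :: (real^5) set)" for f
    by (auto simp: cap_cone_def bounded_iff)
  have lm: "cap_cone f s \<in> lmeasurable" for f :: "real^5"
    using bdd[of f] by (intro bounded_set_imp_lmeasurable) (simp_all add: sets_completionI_sets)
  \<comment> \<open>\<open>measure_orthogonal_image\<close> compares real-valued
    \<open>lebesgue\<close> measures; on these bounded Borel sets they agree with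
    \<open>emeasure lborel\<close>.\<close>
  have fin: "emeasure lborel (cap_cone f s) = ennreal (measure lebesgue (cap_cone f s))" for f :: "real^5"
    using emeasure_eq_ennreal_measure[OF fmeasurableD2[OF lm[of f]]] by (simp add: emeasure_completion)
  show ?thesis
    using emeasure_cap_cone_axis[OF s, of 1] fin[of e] fin[of "axis 1 1"]
      measure_orthogonal_image[OF T(1) lm[of "axis 1 1"]] by (simp add: eq)
qed

section \<open>The expected excess under the uniform measure\<close>

text \<open>Layer cake: the excess of u over t is the length of the set of s with t < s < u. After
  exchanging the integrals, each level s contributes the two opposite cones around \<open>e\<close>
  and \<open>-e\<close>, and their volume is integrated over s from t to 1. The factor 8 pi^2 / 15
  is the volume of the unit ball.\<close>

lemma nn_integral_excess_le:
  fixes e :: "real^5"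
  assumes e: "norm e = 1" and t: "0 \<le> t" "t \<le> 1"
  shows "(\<integral>\<^sup>+ z. ennreal (max 0 (\<bar>inner (z /\<^sub>R norm z) e\<bar> - t)) * indicator (cball 0 1) z \<partial>lborel)
    \<le> ennreal (8 * pi\<^sup>2 / 15 * (3/8 - t + 3/4 * t\<^sup>2))"
proof -
  define f :: "real^5 \<Rightarrow> real \<Rightarrow> ennreal" where
    "f z s = indicator {t<..1} s * indicator (cap_cone e s \<union> cap_cone (-e) s) z" for z s
  \<comment> \<open>One indicator on the product space, so that \<open>f\<close> is visibly jointly
    measurable, as Fubini demands.\<close>
  have f_eq: "f z s = indicator {w. t < snd w \<and> snd w \<le> 1 \<and> norm (fst w) \<le> 1
      \<and> (snd w * norm (fst w) < inner (fst w) e \<or> snd w * norm (fst w) < inner (fst w) (-e))} (z, s)" for z s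
    unfolding f_def by (auto simp: indicator_def cap_cone_def)
  have f_meas: "case_prod f \<in> borel_measurable (lborel \<Otimes>\<^sub>M lborel)"
    unfolding f_eq split_beta prod.collapse by measurable
  have "(\<integral>\<^sup>+ z. ennreal (max 0 (\<bar>inner (z /\<^sub>R norm z) e\<bar> - t)) * indicator (cball 0 1) z \<partial>lborel)
      \<le> (\<integral>\<^sup>+ z. \<integral>\<^sup>+ s. f z s \<partial>lborel \<partial>lborel)"
  proof (rule nn_integral_mono)
    fix z :: "real^5"
    define u where "u = \<bar>inner (z /\<^sub>R norm z) e\<bar>"
    show "ennreal (max 0 (\<bar>inner (z /\<^sub>R norm z) e\<bar> - t)) * indicator (cball 0 1) z \<le> (\<integral>\<^sup>+ s. f z s \<partial>lborel)"
    proof (cases "norm z \<le> 1 \<and> t < u")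
      case True
      \<comment> \<open>At the origin division by zero gives the direction 0, hence u = 0, which
        does not exceed t.\<close>
      have z: "z \<noteq> 0" using True t by (auto simp: u_def)
      have u: "u * norm z = \<bar>inner z e\<bar>" using z by (simp add: u_def abs_mult)
      have u1: "u \<le> 1" using Cauchy_Schwarz_ineq2[of "z /\<^sub>R norm z" e] z e by (simp add: u_def)
      have "ennreal (u - t) = emeasure lborel {t<..<u}" using True by simp
      also have "\<dots> = (\<integral>\<^sup>+ s. indicator {t<..<u} s \<partial>lborel)" by simp
      also have "\<dots> \<le> (\<integral>\<^sup>+ s. f z s \<partial>lborel)"
      proof (rule nn_integral_mono)
        fix s :: real
        have "s * norm z < \<bar>inner z e\<bar>" if "s < u"
          using that z by (simp flip: u)
        then show "indicator {t<..<u} s \<le> f z s"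
          using True u1 by (auto simp: f_def indicator_def cap_cone_def abs_real_def split: if_splits)
      qed
      finally show ?thesis using True by (simp add: u_def indicator_def)
    qed (auto simp: indicator_def u_def)
  qed
  also have "\<dots> = (\<integral>\<^sup>+ s. \<integral>\<^sup>+ z. f z s \<partial>lborel \<partial>lborel)"
    using f_meas by (rule lborel_pair.Fubini'[symmetric])
  also have "\<dots> \<le> (\<integral>\<^sup>+ s. ennreal (pi\<^sup>2 * (8/15 - 4/5 * s + 4/15 * s^3)) * indicator {t..1} s \<partial>lborel)"
  proof (rule nn_integral_mono)
    fix s :: real
    show "(\<integral>\<^sup>+ z. f z s \<partial>lborel) \<le> ennreal (pi\<^sup>2 * (8/15 - 4/5 * s + 4/15 * s^3)) * indicator {t..1} s"
    proof (cases "t < s \<and> s \<le> 1")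
      case True
      define c where "c = pi\<^sup>2 / 2 * (8/15 - 4/5 * s + 4/15 * s^3)"
      have "8/15 - 4/5 * s + 4/15 * s^3 = 4/15 * ((1 - s)\<^sup>2 * (2 + s))"
        by (simp add: field_simps power2_eq_square power3_eq_cube)
      also have "\<dots> \<ge> 0" using True t by simp
      finally have c: "c \<ge> 0" by (simp add: c_def)
      have "(\<integral>\<^sup>+ z. f z s \<partial>lborel) = emeasure lborel (cap_cone e s \<union> cap_cone (-e) s)"
        using True by (simp add: f_def)
      also have "\<dots> \<le> emeasure lborel (cap_cone e s) + emeasure lborel (cap_cone (-e) s)"
        by (intro emeasure_subadditive) auto
      also have "\<dots> \<le> ennreal c + ennreal c"
        unfolding c_def using True t e by (intro add_mono emeasure_cap_cone) auto
      also have "\<dots> = ennreal (c + c)" using c c by (rule ennreal_plus[symmetric])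
      finally show ?thesis using True by (simp add: c_def algebra_simps)
    qed (auto simp: f_def)
  qed
  also have "\<dots> = pi\<^sup>2 * (8/15 * 1 - 2/5 * 1\<^sup>2 + 1/15 * 1^4) - pi\<^sup>2 * (8/15 * t - 2/5 * t\<^sup>2 + 1/15 * t^4)"
  proof (rule nn_integral_FTC_Icc[where F = "\<lambda>x. pi\<^sup>2 * (8/15 * x - 2/5 * x\<^sup>2 + 1/15 * x^4)"])
    show "((\<lambda>x. pi\<^sup>2 * (8/15 * x - 2/5 * x\<^sup>2 + 1/15 * x^4)) has_real_derivative
       pi\<^sup>2 * (8/15 - 4/5 * x + 4/15 * x^3)) (at x)" for x
      by (auto intro!: derivative_eq_intros simp: algebra_simps)
    fix x assume x: "x \<in> {t..1}"
    have "8/15 - 4/5 * x + 4/15 * x^3 = 4/15 * ((1 - x)\<^sup>2 * (2 + x))"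
      by (simp add: field_simps power2_eq_square power3_eq_cube)
    also have "\<dots> \<ge> 0" using x t by simp
    finally show "0 \<le> pi\<^sup>2 * (8/15 - 4/5 * x + 4/15 * x^3)" by simp
  qed (use t in auto)
  \<comment> \<open>Only the term - pi^2 t^4 / 15 is dropped, which leaves a bound quadratic in
    t.\<close>
  also have "\<dots> \<le> ennreal (8 * pi\<^sup>2 / 15 * (3/8 - t + 3/4 * t\<^sup>2))"
    by (intro ennreal_leI) (simp add: field_simps)
  finally show ?thesis .
qed

section \<open>Finite approximation of the uniform measure\<close>

lemma abs_max_excess_le:
  fixes a b t :: real
  shows "max 0 (\<bar>a\<bar> - t) \<le> max 0 (\<bar>b\<bar> - t) + \<bar>a - b\<bar>"
  by linarith

text \<open>Cover the sphere by finitely many balls of radius \<open>\<epsilon>\<close>, cut the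
  unit ball into disjoint cells according to the direction of z, and weight each centre by the
  relative volume of its cell. The excess is 1-Lipschitz in the direction, so moving a cell to its
  centre costs at most \<open>\<epsilon>\<close>, uniformly in \<open>e\<close> and
  \<open>t\<close>.\<close>

lemma finite_approx_uniform_sphere:
  assumes \<epsilon>: "\<epsilon> > 0"
  obtains n and \<mu> :: "nat \<Rightarrow> real" and a :: "nat \<Rightarrow> real^5"
  where "\<And>i. i < n \<Longrightarrow> 0 \<le> \<mu> i" "\<And>i. i < n \<Longrightarrow> norm (a i) = 1" "(\<Sum>i<n. \<mu> i) = 1"
    "\<And>e t. norm e = 1 \<Longrightarrow> 0 \<le> t \<Longrightarrow> t \<le> 1 \<Longrightarrow>
      (\<Sum>i<n. \<mu> i * max 0 (\<bar>inner (a i) e\<bar> - t)) \<le> 3/8 - t + 3/4 * t\<^sup>2 + \<epsilon>"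
proof -
  define V where "V = 8 * pi\<^sup>2 / 15"
  have V: "V > 0" by (simp add: V_def)
  have vol: "emeasure lborel (cball (0::real^5) 1) = ennreal V"
    by (simp add: emeasure_cball eval_unit_ball_vol V_def)
  have "compact (sphere (0::real^5) 1)" by simp
  then obtain C where C: "finite C" "C \<subseteq> sphere (0::real^5) 1" "sphere 0 1 \<subseteq> (\<Union>x\<in>C. ball x \<epsilon>)"
  proof (rule compactE_image)
    show "sphere (0::real^5) 1 \<subseteq> (\<Union>x\<in>sphere 0 1. ball x \<epsilon>)"
      using \<epsilon> centre_in_ball by blast
  qed auto
  obtain a n where a: "C = a ` {i::nat. i < n}"
    using C(1) by (metis finite_imp_nat_seg_image_inj_on)
  define dir where "dir z = z /\<^sub>R norm z" for z :: "real^5"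
  have [measurable]: "dir \<in> borel_measurable borel" unfolding dir_def by measurable
  \<comment> \<open>The origin has no direction and is left out; it is a null set, so the cells
    still have total volume \<open>V\<close>.\<close>
  define A where "A i = {z \<in> cball 0 1 - {0}. dist (a i) (dir z) < \<epsilon>}" for i
  define P where "P = disjointed A"
  have A_meas: "A i \<in> sets borel" for i unfolding A_def by measurable
  then have P_meas [measurable]: "P i \<in> sets borel" for i
    unfolding P_def using sets.range_disjointed_sets[of A borel] by auto
  have P_sub: "P i \<subseteq> A i" for i unfolding P_def by (rule disjointed_subset)
  have disj: "disjoint_family P" unfolding P_def by (rule disjoint_family_disjointed)
  have Un: "(\<Union>i<n. P i) = cball 0 1 - {0}"
  proof -
    have "(\<Union>i<n. P i) = (\<Union>i<n. A i)"
      unfolding P_def using finite_UN_disjointed_eq[of A n] by (simp add: atLeast0LessThan)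
    also have "\<dots> = cball 0 1 - {0}"
    proof (intro equalityI subsetI)
      fix z assume z: "z \<in> cball 0 1 - {0 :: real^5}"
      then have "dir z \<in> sphere 0 1" by (simp add: dir_def)
      then obtain x where "x \<in> C" "dir z \<in> ball x \<epsilon>" using C(3) by blast
      then show "z \<in> (\<Union>i<n. A i)" using z by (auto simp: a A_def)
    qed (auto simp: A_def)
    finally show ?thesis .
  qed
  define m where "m i = measure lborel (P i)" for i
  have m: "emeasure lborel (P i) = ennreal (m i)" for i
  proof -
    have "emeasure lborel (P i) \<le> emeasure lborel (cball (0::real^5) 1)"
      using P_sub[of i] by (intro emeasure_mono) (auto simp: A_def)
    then have "emeasure lborel (P i) \<noteq> \<infinity>" unfolding vol by (auto simp: top_unique)
    then show ?thesis unfolding m_def by (simp add: emeasure_eq_ennreal_measure)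
  qed
  have m0: "m i \<ge> 0" for i by (simp add: m_def)
  have "ennreal (\<Sum>i<n. m i) = (\<Sum>i<n. emeasure lborel (P i))"
    using m0 by (simp add: m)
  also have "\<dots> = emeasure lborel (\<Union>i<n. P i)"
    using disj by (intro sum_emeasure) (auto simp: disjoint_family_on_def)
  also have "\<dots> = ennreal V"
    unfolding Un by (subst emeasure_Diff_null_set) (auto simp: vol)
  finally have msum: "(\<Sum>i<n. m i) = V" using m0 V by (simp add: sum_nonneg)
  show thesis
  proof (rule that[of n "\<lambda>i. m i / V" a])
    show "0 \<le> m i / V" for i using m0 V by simp
    show "norm (a i) = 1" if "i < n" for i using C(2) a that by auto
    show "(\<Sum>i<n. m i / V) = 1" using msum V by (simp flip: sum_divide_distrib)
    fix e :: "real^5" and t :: real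
    assume e: "norm e = 1" and t: "0 \<le> t" "t \<le> 1"
    define g where "g x = max 0 (\<bar>inner x e\<bar> - t)" for x
    have [measurable]: "g \<in> borel_measurable borel" unfolding g_def by measurable
    have g0: "g x \<ge> 0" for x by (simp add: g_def)
    have g_le: "g (a i) \<le> g (dir z) + \<epsilon>" if "z \<in> P i" for i z
    proof -
      have "\<bar>inner (a i) e - inner (dir z) e\<bar> \<le> norm (a i - dir z) * norm e"
        using Cauchy_Schwarz_ineq2[of "a i - dir z" e] by (simp add: inner_diff_left)
      also have "\<dots> \<le> \<epsilon>" using that P_sub[of i] by (auto simp: A_def e dist_norm)
      finally show ?thesis
        unfolding g_def using abs_max_excess_le[of "inner (a i) e" t "inner (dir z) e"] by linarith
    qed
    \<comment> \<open>Completing the square shows that the bound is positive, so that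
      \<open>ennreal\<close> does not truncate it.\<close>
    have "3/8 - t + 3/4 * t\<^sup>2 = 3/4 * (t - 2/3)\<^sup>2 + 1/24"
      by (simp add: power2_eq_square field_simps)
    then have pos: "3/8 - t + 3/4 * t\<^sup>2 \<ge> 0" by simp
    have "ennreal (\<Sum>i<n. m i * g (a i)) = (\<Sum>i<n. ennreal (g (a i)) * emeasure lborel (P i))"
      using m0 g0 by (simp add: m ennreal_mult' mult.commute flip: sum_ennreal)
    also have "\<dots> = (\<integral>\<^sup>+ z. (\<Sum>i<n. ennreal (g (a i)) * indicator (P i) z) \<partial>lborel)"
      by (subst nn_integral_sum) (auto simp: nn_integral_cmult_indicator)
    also have "\<dots> \<le> (\<integral>\<^sup>+ z. ennreal (g (dir z)) * indicator (cball 0 1) z + ennreal \<epsilon> * indicator (cball 0 1) z \<partial>lborel)"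
    proof (rule nn_integral_mono)
      fix z
      show "(\<Sum>i<n. ennreal (g (a i)) * indicator (P i) z)
         \<le> ennreal (g (dir z)) * indicator (cball 0 1) z + ennreal \<epsilon> * indicator (cball 0 1) z"
      proof (cases "\<exists>j<n. z \<in> P j")
        case True
        then obtain j where j: "j < n" "z \<in> P j" by blast
        have "(\<Sum>i<n. ennreal (g (a i)) * indicator (P i) z) = (\<Sum>i<n. if i = j then ennreal (g (a j)) else 0)"
          using disj j(2) by (intro sum.cong) (auto simp: disjoint_family_on_def indicator_def)
        also have "\<dots> = ennreal (g (a j))" using j by simp
        also have "\<dots> \<le> ennreal (g (dir z) + \<epsilon>)" using g_le[OF j(2)] by (rule ennreal_leI)
        also have "\<dots> = ennreal (g (dir z)) + ennreal \<epsilon>" using g0 \<epsilon> by simp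
        also have "z \<in> cball 0 1" using j Un by blast
        ultimately show ?thesis using \<open>z \<in> cball 0 1\<close> by (simp add: indicator_def)
      next
        case False
        then have "(\<Sum>i<n. ennreal (g (a i)) * indicator (P i) z) = 0"
          by (intro sum.neutral) (auto simp: indicator_def)
        then show ?thesis by simp
      qed
    qed
    also have "\<dots> = (\<integral>\<^sup>+ z. ennreal (g (dir z)) * indicator (cball 0 1) z \<partial>lborel) + ennreal \<epsilon> * ennreal V"
    proof (subst nn_integral_add)
      have [measurable]: "cball (0::real^5) 1 \<in> sets borel" by simp
      show "(\<lambda>z. ennreal (g (dir z)) * indicator (cball 0 1) z) \<in> borel_measurable lborel"
        "(\<lambda>z::real^5. ennreal \<epsilon> * indicator (cball 0 1) z) \<in> borel_measurable lborel"
        by measurable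
    qed (simp add: nn_integral_cmult_indicator vol)
    also have "\<dots> \<le> ennreal (V * (3/8 - t + 3/4 * t\<^sup>2)) + ennreal \<epsilon> * ennreal V"
      using nn_integral_excess_le[OF e t] by (intro add_right_mono) (simp add: g_def dir_def V_def)
    also have "\<dots> = ennreal (V * (3/8 - t + 3/4 * t\<^sup>2) + \<epsilon> * V)"
      using V \<epsilon> pos by (simp add: ennreal_mult')
    finally have "(\<Sum>i<n. m i * g (a i)) \<le> V * (3/8 - t + 3/4 * t\<^sup>2) + \<epsilon> * V"
      using V \<epsilon> pos by (subst (asm) ennreal_le_iff) auto
    then have "(\<Sum>i<n. m i * g (a i)) / V \<le> 3/8 - t + 3/4 * t\<^sup>2 + \<epsilon>"
      using V by (simp add: field_simps)
    then show "(\<Sum>i<n. m i / V * max 0 (\<bar>inner (a i) e\<bar> - t)) \<le> 3/8 - t + 3/4 * t\<^sup>2 + \<epsilon>"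
      by (simp add: g_def sum_divide_distrib)
  qed
qed

section \<open>The Davie-Reeds matrix and its value on vectors\<close>

text \<open>The double sum is the squared Frobenius norm of the second moment matrix
  \<open>T\<close>. Its diagonal entries alone, which sum to 1, already have squares summing to at
  least 1 / dim.\<close>

lemma sum_inner_power2_ge:
  fixes a :: "nat \<Rightarrow> 'a::euclidean_space" and \<mu> :: "nat \<Rightarrow> real"
  assumes unit: "\<And>i. i < n \<Longrightarrow> norm (a i) = 1" and sum1: "(\<Sum>i<n. \<mu> i) = 1"
  shows "1 / DIM('a) \<le> (\<Sum>i<n. \<Sum>j<n. \<mu> i * \<mu> j * (inner (a i) (a j))\<^sup>2)"
proof -
  define T where "T b c = (\<Sum>i<n. \<mu> i * (inner (a i) b * inner (a i) c))" for b c
  have trace: "(\<Sum>b\<in>Basis. T b b) = 1"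
  proof -
    have "(\<Sum>b\<in>Basis. T b b) = (\<Sum>i<n. \<mu> i * (\<Sum>b\<in>Basis. inner (a i) b * inner (a i) b))"
      unfolding T_def by (subst sum.swap) (simp add: sum_distrib_left)
    also have "\<dots> = (\<Sum>i<n. \<mu> i * inner (a i) (a i))"
      by (simp flip: euclidean_inner)
    also have "\<dots> = (\<Sum>i<n. \<mu> i)"
      using unit by (intro sum.cong) (auto simp: norm_eq_1)
    finally show ?thesis using sum1 by simp
  qed
  have "(\<Sum>i<n. \<Sum>j<n. \<mu> i * \<mu> j * (inner (a i) (a j))\<^sup>2)
     = (\<Sum>i<n. \<Sum>j<n. \<Sum>b\<in>Basis. \<Sum>c\<in>Basis. (\<mu> i * (inner (a i) b * inner (a i) c)) * (\<mu> j * (inner (a j) b * inner (a j) c)))"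
  proof (intro sum.cong refl)
    fix i j
    have "(inner (a i) (a j))\<^sup>2 = (\<Sum>b\<in>Basis. inner (a i) b * inner (a j) b) * (\<Sum>c\<in>Basis. inner (a i) c * inner (a j) c)"
      unfolding power2_eq_square by (simp flip: euclidean_inner)
    then show "\<mu> i * \<mu> j * (inner (a i) (a j))\<^sup>2 = (\<Sum>b\<in>Basis. \<Sum>c\<in>Basis. (\<mu> i * (inner (a i) b * inner (a i) c)) * (\<mu> j * (inner (a j) b * inner (a j) c)))"
      by (simp add: sum_product sum_distrib_left mult_ac)
  qed
  also have "\<dots> = (\<Sum>i<n. \<Sum>b\<in>Basis. \<Sum>c\<in>Basis. \<Sum>j<n. (\<mu> i * (inner (a i) b * inner (a i) c)) * (\<mu> j * (inner (a j) b * inner (a j) c)))"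
    by (subst (2) sum.swap, subst sum.swap) simp
  also have "\<dots> = (\<Sum>b\<in>Basis. \<Sum>c\<in>Basis. \<Sum>i<n. \<Sum>j<n. (\<mu> i * (inner (a i) b * inner (a i) c)) * (\<mu> j * (inner (a j) b * inner (a j) c)))"
    by (subst (2) sum.swap, subst sum.swap) simp
  also have "\<dots> = (\<Sum>b\<in>Basis. \<Sum>c\<in>Basis. (T b c)\<^sup>2)"
    by (simp add: T_def power2_eq_square sum_product)
  finally have eq: "(\<Sum>i<n. \<Sum>j<n. \<mu> i * \<mu> j * (inner (a i) (a j))\<^sup>2) = (\<Sum>b\<in>Basis. \<Sum>c\<in>Basis. (T b c)\<^sup>2)" .
  have "1 = (\<Sum>b\<in>Basis. T b b * 1)\<^sup>2" by (simp add: trace)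
  also have "\<dots> \<le> (\<Sum>b\<in>Basis. (T b b)\<^sup>2) * (\<Sum>b\<in>(Basis::'a set). 1\<^sup>2)"
    by (rule Cauchy_Schwarz_ineq_sum)
  also have "\<dots> = DIM('a) * (\<Sum>b\<in>Basis. (T b b)\<^sup>2)" by simp
  also have "\<dots> \<le> DIM('a) * (\<Sum>b\<in>Basis. \<Sum>c\<in>Basis. (T b c)\<^sup>2)"
    by (intro mult_left_mono sum_mono member_le_sum[of _ _ "\<lambda>c. (T _ c)\<^sup>2"]) auto
  finally have "1 \<le> DIM('a) * (\<Sum>i<n. \<Sum>j<n. \<mu> i * \<mu> j * (inner (a i) (a j))\<^sup>2)"
    by (simp only: eq)
  then show ?thesis by (simp add: divide_le_eq mult.commute)
qed

text \<open>The kernel part carries the product weight, but the diagonal part a single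
  \<open>\<mu> i\<close>: the delta stands for the measure itself placed on the diagonal, so that it
  pairs with f and g to the mean of f g.\<close>

definition davie_reeds_mat :: "real \<Rightarrow> nat \<Rightarrow> (nat \<Rightarrow> real) \<Rightarrow> (nat \<Rightarrow> 'a::real_inner) \<Rightarrow> real mat" where
  "davie_reeds_mat \<kappa> n \<mu> a =
     Matrix.mat n n (\<lambda>(i, j). \<mu> i * \<mu> j * inner (a i) (a j) - (if i = j then \<kappa> * \<mu> i else 0))"

text \<open>With \<open>q\<close> arbitrary, one identity serves both inner products of vectors and
  products of signs.\<close>

lemma davie_reeds_mat_form:
  "(\<Sum>i<dim_row (davie_reeds_mat \<kappa> n \<mu> a). \<Sum>j<dim_col (davie_reeds_mat \<kappa> n \<mu> a).
      davie_reeds_mat \<kappa> n \<mu> a $$ (i, j) * q i j)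
    = (\<Sum>i<n. \<Sum>j<n. \<mu> i * \<mu> j * inner (a i) (a j) * q i j) - \<kappa> * (\<Sum>i<n. \<mu> i * q i i)"
proof -
  have "(\<Sum>j<n. davie_reeds_mat \<kappa> n \<mu> a $$ (i, j) * q i j)
      = (\<Sum>j<n. \<mu> i * \<mu> j * inner (a i) (a j) * q i j) - \<kappa> * (\<mu> i * q i i)" if "i < n" for i
  proof -
    have "(\<Sum>j<n. davie_reeds_mat \<kappa> n \<mu> a $$ (i, j) * q i j)
      = (\<Sum>j<n. \<mu> i * \<mu> j * inner (a i) (a j) * q i j - (if i = j then \<kappa> * (\<mu> i * q i i) else 0))"
      using that by (intro sum.cong) (auto simp: davie_reeds_mat_def algebra_simps)
    also have "\<dots> = (\<Sum>j<n. \<mu> i * \<mu> j * inner (a i) (a j) * q i j) - \<kappa> * (\<mu> i * q i i)"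
      using that by (simp add: sum_subtractf)
    finally show ?thesis .
  qed
  then have "(\<Sum>i<n. \<Sum>j<n. davie_reeds_mat \<kappa> n \<mu> a $$ (i, j) * q i j)
    = (\<Sum>i<n. (\<Sum>j<n. \<mu> i * \<mu> j * inner (a i) (a j) * q i j) - \<kappa> * (\<mu> i * q i i))"
    by simp
  moreover have "dim_row (davie_reeds_mat \<kappa> n \<mu> a) = n" "dim_col (davie_reeds_mat \<kappa> n \<mu> a) = n"
    by (simp_all add: davie_reeds_mat_def)
  ultimately show ?thesis by (simp add: sum_subtractf sum_distrib_left)
qed

text \<open>Coordinates padded with zeros. The padding lets points of the five-dimensional sphere
  space compete in \<open>SDP d\<close> for every larger d.\<close>

lemma euclidean_embed_vec:
  assumes "DIM('a::euclidean_space) \<le> d"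
  obtains \<iota> :: "'a::euclidean_space \<Rightarrow> real Matrix.vec" where "\<And>x. \<iota> x \<in> carrier_vec d" "\<And>x y. scalar_prod (\<iota> x) (\<iota> y) = inner x y"
proof -
  obtain \<beta> :: "nat \<Rightarrow> 'a" where \<beta>: "bij_betw \<beta> {..<DIM('a)} Basis"
    using ex_bij_betw_nat_finite[of "Basis :: 'a set"] by (auto simp: atLeast0LessThan)
  define \<iota> :: "'a \<Rightarrow> real Matrix.vec" where "\<iota> x = Matrix.vec d (\<lambda>i. if i < DIM('a) then inner x (\<beta> i) else 0)" for x
  show thesis
  proof (rule that[of \<iota>])
    show "\<iota> x \<in> carrier_vec d" for x by (simp add: \<iota>_def)
    fix x y
    have "scalar_prod (\<iota> x) (\<iota> y) = (\<Sum>i<d. if i < DIM('a) then inner x (\<beta> i) * inner y (\<beta> i) else 0)"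
      by (auto simp: \<iota>_def scalar_prod_def atLeast0LessThan intro!: sum.cong)
    also have "\<dots> = (\<Sum>i<DIM('a). inner x (\<beta> i) * inner y (\<beta> i))"
      using assms by (intro sum.mono_neutral_cong_right) auto
    also have "\<dots> = (\<Sum>b\<in>Basis. inner x b * inner y b)"
      by (rule sum.reindex_bij_betw[OF \<beta>])
    finally show "scalar_prod (\<iota> x) (\<iota> y) = inner x y" by (simp flip: euclidean_inner)
  qed
qed

text \<open>Both families are the embedded points themselves: the kernel part becomes the sum of
  squared inner products, and the diagonal part is exactly \<open>\<kappa>\<close> because the
  points are unit vectors.\<close>

lemma SDP_davie_reeds_mat_ge:
  fixes a :: "nat \<Rightarrow> 'a::euclidean_space"
  assumes d: "DIM('a) \<le> d" and unit: "\<And>i. i < n \<Longrightarrow> norm (a i) = 1" and sum1: "(\<Sum>i<n. \<mu> i) = 1"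
  shows "1 / DIM('a) - \<kappa> \<le> SDP d (davie_reeds_mat \<kappa> n \<mu> a)"
proof -
  obtain \<iota> :: "'a \<Rightarrow> real Matrix.vec" where \<iota>: "\<And>x. \<iota> x \<in> carrier_vec d" "\<And>x y. scalar_prod (\<iota> x) (\<iota> y) = inner x y"
    using euclidean_embed_vec[OF d] by blast
  let ?M = "davie_reeds_mat \<kappa> n \<mu> a"
  have sphere: "\<iota> (a i) \<in> unit_sphere d" if "i < n" for i
    using that unit[OF that] by (simp add: unit_sphere_def vnorm_def \<iota> norm_eq_1)
  have "(\<Sum>i<n. \<mu> i * inner (a i) (a i)) = 1"
    using unit sum1 by (simp add: norm_eq_1)
  then have "1 / DIM('a) - \<kappa> \<le> (\<Sum>i<n. \<Sum>j<n. \<mu> i * \<mu> j * inner (a i) (a j) * inner (a i) (a j))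
      - \<kappa> * (\<Sum>i<n. \<mu> i * inner (a i) (a i))"
    using sum_inner_power2_ge[of n a \<mu>, OF unit sum1] by (simp add: power2_eq_square mult.assoc)
  also have "\<dots> = (\<Sum>i<dim_row ?M. \<Sum>j<dim_col ?M. ?M $$ (i, j) * scalar_prod (\<iota> (a i)) (\<iota> (a j)))"
    by (simp only: davie_reeds_mat_form \<iota>)
  also have "\<dots> \<le> SDP d ?M"
    unfolding SDP_def using sphere
    by (intro cSup_upper sdp_values_bdd_above sdp_valuesI) (auto simp: davie_reeds_mat_def)
  finally show ?thesis .
qed


section \<open>The value of the Davie-Reeds form on signs\<close>

text \<open>Termwise x is at most its excess over t plus t, and the excess, being nonnegative, may
  be summed over all indices. The set \<open>A\<close> then enters only through its mass.\<close>

lemma weighted_subset_sum_excess_le: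
  fixes x :: "nat \<Rightarrow> real"
  assumes "A \<subseteq> {..<n}" "\<And>i. i < n \<Longrightarrow> 0 \<le> \<mu> i"
  shows "(\<Sum>i\<in>A. \<mu> i * x i) \<le> (\<Sum>i<n. \<mu> i * max 0 (\<bar>x i\<bar> - t)) + t * (\<Sum>i\<in>A. \<mu> i)"
proof -
  have "(\<Sum>i\<in>A. \<mu> i * x i) \<le> (\<Sum>i\<in>A. \<mu> i * (max 0 (\<bar>x i\<bar> - t) + t))"
    using assms by (intro sum_mono mult_left_mono) auto
  also have "\<dots> = (\<Sum>i\<in>A. \<mu> i * max 0 (\<bar>x i\<bar> - t)) + t * (\<Sum>i\<in>A. \<mu> i)"
    by (simp add: distrib_left sum.distrib sum_distrib_left mult.commute)
  also have "(\<Sum>i\<in>A. \<mu> i * max 0 (\<bar>x i\<bar> - t)) \<le> (\<Sum>i<n. \<mu> i * max 0 (\<bar>x i\<bar> - t))"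
    using assms by (intro sum_mono2) auto
  finally show ?thesis by simp
qed

text \<open>
  On the set \<open>A\<close> of indices where the signs \<open>f\<close> and \<open>g\<close> agree let \<open>U\<close> be the weighted sum of the
  vectors \<open>f i *\<^sub>R a i\<close>, and \<open>V\<close> the one on the complement. The two marginals are \<open>U + V\<close> and
  \<open>U - V\<close>, so their inner product is at most the squared norm of \<open>U\<close>.
\<close>
lemma davie_reeds_sign_form_le:
  fixes a :: "nat \<Rightarrow> 'a::real_inner" and f g \<mu> :: "nat \<Rightarrow> real"
  assumes \<kappa>: "0 < \<kappa>" "\<kappa> \<le> c"
    and \<mu>: "\<And>i. i < n \<Longrightarrow> 0 \<le> \<mu> i" "(\<Sum>i<n. \<mu> i) = 1"
    and unit: "\<And>i. i < n \<Longrightarrow> norm (a i) = 1"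
    and signs: "\<And>i. i < n \<Longrightarrow> f i \<in> {-1, 1}" "\<And>i. i < n \<Longrightarrow> g i \<in> {-1, 1}"
    and excess: "\<And>e s. norm e = 1 \<Longrightarrow> 0 < s \<Longrightarrow> s \<le> 1 \<Longrightarrow> c < s\<^sup>2 + \<kappa> \<Longrightarrow>
        2 * s * (\<Sum>i<n. \<mu> i * max 0 (\<bar>inner (a i) e\<bar> - \<kappa> / s)) \<le> s\<^sup>2 + c - \<kappa>"
  shows "(\<Sum>i<n. \<Sum>j<n. \<mu> i * \<mu> j * inner (a i) (a j) * (f i * g j)) - \<kappa> * (\<Sum>i<n. \<mu> i * (f i * g i)) \<le> c"
proof -
  define A where "A = {i. i < n \<and> f i = g i}"
  define B where "B = {i. i < n \<and> f i \<noteq> g i}"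
  have split: "sum h {..<n} = sum h A + sum h B" for h :: "nat \<Rightarrow> 'b::comm_monoid_add"
    by (subst sum.union_disjoint[symmetric]) (auto simp: A_def B_def intro!: sum.cong)
  have gB: "g i = - f i" if "i \<in> B" for i
    using that signs[of i] by (auto simp: B_def)
  have gA: "g i = f i" if "i \<in> A" for i
    using that by (auto simp: A_def)
  define U where "U = (\<Sum>i\<in>A. (\<mu> i * f i) *\<^sub>R a i)"
  define V where "V = (\<Sum>i\<in>B. (\<mu> i * f i) *\<^sub>R a i)"
  define m where "m = (\<Sum>i\<in>A. \<mu> i)"
  have F: "(\<Sum>i<n. (\<mu> i * f i) *\<^sub>R a i) = U + V" by (simp add: split U_def V_def)
  have G: "(\<Sum>i<n. (\<mu> i * g i) *\<^sub>R a i) = U - V"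
    by (simp add: split U_def V_def gA gB sum_negf)
  have mB: "(\<Sum>i\<in>B. \<mu> i) = 1 - m" using \<mu>(2) by (simp add: split m_def)
  have m0: "m \<ge> 0" unfolding m_def using \<mu>(1) by (intro sum_nonneg) (auto simp: A_def)
  have m1: "m \<le> 1"
    using mB sum_nonneg[of B \<mu>] \<mu>(1) by (auto simp: B_def)
  have ff: "f i * f i = 1" if "i < n" for i using signs(1)[OF that] by auto
  have fg: "f i * g i = 1" if "i \<in> A" for i
    using gA[OF that] ff that by (simp add: A_def)
  have fg': "f i * g i = - 1" if "i \<in> B" for i
    using gB[OF that] ff that by (simp add: B_def)
  have diag: "(\<Sum>i<n. \<mu> i * (f i * g i)) = 2 * m - 1"
  proof -
    have "(\<Sum>i\<in>A. \<mu> i * (f i * g i)) = m"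
      by (simp add: m_def fg)
    moreover have "(\<Sum>i\<in>B. \<mu> i * (f i * g i)) = - (1 - m)"
      by (simp add: fg' sum_negf mB)
    ultimately show ?thesis by (simp add: split)
  qed
  have "(\<Sum>i<n. \<Sum>j<n. \<mu> i * \<mu> j * inner (a i) (a j) * (f i * g j))
     = inner (\<Sum>i<n. (\<mu> i * f i) *\<^sub>R a i) (\<Sum>j<n. (\<mu> j * g j) *\<^sub>R a j)"
    by (simp only: inner_sum_left) (simp add: inner_sum_right sum_distrib_left mult_ac)
  also have "\<dots> = (norm U)\<^sup>2 - (norm V)\<^sup>2"
    unfolding F G
    by (simp add: inner_add_left inner_diff_right power2_norm_eq_inner inner_commute[of V U])
  also have "\<dots> \<le> (norm U)\<^sup>2" by simp
  finally have le: "(\<Sum>i<n. \<Sum>j<n. \<mu> i * \<mu> j * inner (a i) (a j) * (f i * g j)) - \<kappa> * (\<Sum>i<n. \<mu> i * (f i * g i))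
     \<le> (norm U)\<^sup>2 + \<kappa> - 2 * \<kappa> * m"
    by (simp add: diag algebra_simps)
  define s where "s = norm U"
  show ?thesis
  proof (cases "c < s\<^sup>2 + \<kappa> \<and> s \<noteq> 0")
    \<comment> \<open>Here dropping the term in m from \<open>le\<close> suffices, with
      \<open>\<kappa> \<le> c\<close> covering s = 0. This is why \<open>excess\<close> is assumed
      only for s with \<open>c < s\<^sup>2 + \<kappa>\<close>.\<close>
    case False
    then have "(norm U)\<^sup>2 + \<kappa> \<le> c" using \<kappa> by (auto simp: s_def)
    moreover have "0 \<le> \<kappa> * m" using \<kappa> m0 by simp
    ultimately show ?thesis using le by linarith
  next
    case True
    then have s: "s > 0" by (simp add: s_def)
    define e where "e = U /\<^sub>R s"
    have e: "norm e = 1" using s by (simp add: e_def s_def)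
    \<comment> \<open>The triangle inequality bounds s by the mass m of \<open>A\<close>, hence by
      1, the range in which \<open>excess\<close> is available.\<close>
    have "s \<le> (\<Sum>i\<in>A. norm ((\<mu> i * f i) *\<^sub>R a i))"
      unfolding s_def U_def by (rule norm_sum)
    also have "\<dots> = m"
      unfolding m_def
    proof (intro sum.cong refl)
      fix i assume "i \<in> A"
      then have i: "i < n" by (simp add: A_def)
      show "norm ((\<mu> i * f i) *\<^sub>R a i) = \<mu> i"
        using signs(1)[OF i] \<mu>(1)[OF i] unit[OF i] by (auto simp: abs_mult)
    qed
    finally have s1: "s \<le> 1" using m1 by simp
    define \<Phi> where "\<Phi> = (\<Sum>i<n. \<mu> i * max 0 (\<bar>inner (a i) e\<bar> - \<kappa> / s))"
    have "s = inner U e"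
      using s by (simp add: e_def s_def flip: power2_norm_eq_inner) (simp add: power2_eq_square)
    also have "\<dots> = (\<Sum>i\<in>A. \<mu> i * (f i * inner (a i) e))"
      by (simp add: U_def inner_sum_left mult.assoc)
    \<comment> \<open>With the threshold \<open>\<kappa> / s\<close>, multiplication by s turns the
      last term into \<open>\<kappa> * m\<close>, and twice it cancels the term in m of
      \<open>le\<close>.\<close>
    also have "\<dots> \<le> (\<Sum>i<n. \<mu> i * max 0 (\<bar>f i * inner (a i) e\<bar> - \<kappa> / s)) + \<kappa> / s * m"
      unfolding m_def using \<mu>(1) by (intro weighted_subset_sum_excess_le) (auto simp: A_def)
    also have "(\<Sum>i<n. \<mu> i * max 0 (\<bar>f i * inner (a i) e\<bar> - \<kappa> / s)) = \<Phi>"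
      unfolding \<Phi>_def by (intro sum.cong refl) (use signs(1) in \<open>force simp: abs_mult\<close>)
    finally have "s * s \<le> s * (\<Phi> + \<kappa> / s * m)" using s by (intro mult_left_mono) auto
    also have "\<dots> = s * \<Phi> + \<kappa> * m" using s by (simp add: field_simps)
    finally have "s\<^sup>2 \<le> s * \<Phi> + \<kappa> * m" by (simp add: power2_eq_square)
    moreover have "2 * s * \<Phi> \<le> s\<^sup>2 + c - \<kappa>"
      unfolding \<Phi>_def using excess[OF e s s1] True by blast
    ultimately show ?thesis using le unfolding s_def by linarith
  qed
qed

text \<open>A point of the sphere in dimension one is a sign, and scalar products are products of
  signs. The signs are prescribed only below n, because \<open>sdp_values\<close> constrains its
  vectors only there.\<close>

lemma SDP_1_davie_reeds_mat_le:
  assumes "\<And>f g. (\<And>i. i < n \<Longrightarrow> f i \<in> {-1, 1}) \<Longrightarrow> (\<And>i. i < n \<Longrightarrow> g i \<in> {-1, 1}) \<Longrightarrow>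
    (\<Sum>i<n. \<Sum>j<n. \<mu> i * \<mu> j * inner (a i) (a j) * (f i * g j)) - \<kappa> * (\<Sum>i<n. \<mu> i * (f i * g i)) \<le> c"
  shows "SDP 1 (davie_reeds_mat \<kappa> n \<mu> a) \<le> c"
  unfolding SDP_def
proof (rule cSup_least)
  let ?M = "davie_reeds_mat \<kappa> n \<mu> a"
  show "sdp_values 1 ?M \<noteq> {}" by (rule sdp_values_nonempty) simp
  fix r assume "r \<in> sdp_values 1 ?M"
  then obtain x y where r: "r = (\<Sum>i<dim_row ?M. \<Sum>j<dim_col ?M. ?M $$ (i, j) * scalar_prod (x i) (y j))"
    and x: "\<forall>i<dim_row ?M. x i \<in> unit_sphere 1" and y: "\<forall>j<dim_col ?M. y j \<in> unit_sphere 1"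
    by (rule sdp_valuesE)
  have dim: "dim_row ?M = n" "dim_col ?M = n" by (simp_all add: davie_reeds_mat_def)
  have sgn: "vec_index v 0 \<in> {-1, 1}" if "v \<in> unit_sphere 1" for v :: "real Matrix.vec"
    using that by (auto simp: unit_sphere_def vnorm_def scalar_prod_def square_eq_1_iff)
  have "r = (\<Sum>i<dim_row ?M. \<Sum>j<dim_col ?M. ?M $$ (i, j) * (vec_index (x i) 0 * vec_index (y j) 0))"
    unfolding r using y by (intro sum.cong refl) (auto simp: scalar_prod_def unit_sphere_def)
  also have "\<dots> \<le> c"
    unfolding davie_reeds_mat_form using x y sgn unfolding dim by (intro assms) blast+
  finally show "r \<le> c" .
qed

section \<open>Choice of parameters and numerical estimates\<close>

theorem mainTheorem3:
  shows "K_G 5 \<ge> 1.49339 \<and> (\<forall>d\<ge>5. K_G d \<ge> 1.49339)"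
proof -
  obtain n and \<mu> :: "nat \<Rightarrow> real" and a :: "nat \<Rightarrow> real^5"
    where \<mu>: "\<And>i. i < n \<Longrightarrow> 0 \<le> \<mu> i" and unit: "\<And>i. i < n \<Longrightarrow> norm (a i) = 1" and sum1: "(\<Sum>i<n. \<mu> i) = 1"
      and excess: "\<And>e t. norm e = 1 \<Longrightarrow> 0 \<le> t \<Longrightarrow> t \<le> 1 \<Longrightarrow>
        (\<Sum>i<n. \<mu> i * max 0 (\<bar>inner (a i) e\<bar> - t)) \<le> 3/8 - t + 3/4 * t\<^sup>2 + 1/10^6"
    using finite_approx_uniform_sphere[of "1/10^6"] by auto
  let ?M = "davie_reeds_mat (1/25) n \<mu> a"
  \<comment> \<open>Vectors give 1/5 - 1/25 = 0.16, so the sign value has to stay below 0.16 /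
    1.49339 = 0.107138...; the bound is this number rounded down.\<close>
  have "SDP 1 ?M \<le> 0.10713"
  proof (rule SDP_1_davie_reeds_mat_le, rule davie_reeds_sign_form_le)
    fix e :: "real^5" and s :: real
    assume e: "norm e = 1" and s: "0 < s" "s \<le> 1" "0.10713 < s\<^sup>2 + 1/25"
    \<comment> \<open>Since 1/16 + 1/25 = 0.1025 is below 0.10713, small s are excluded. This keeps
      the threshold 1/(25 s) below 1 and s above the small root 0.018 used further on.\<close>
    have s4: "s > 1/4"
    proof (rule ccontr)
      assume "\<not> s > 1/4"
      then have "s\<^sup>2 \<le> (1/4)\<^sup>2" using s(1) by (intro power_mono) auto
      then show False using s(3) by (simp add: power2_eq_square)
    qed
    have "2 * s * (\<Sum>i<n. \<mu> i * max 0 (\<bar>inner (a i) e\<bar> - 1/25 / s))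
        \<le> 2 * s * (3/8 - 1/25 / s + 3/4 * (1/25 / s)\<^sup>2 + 1/10^6)"
      using s4 e by (intro mult_left_mono excess) (auto simp: field_simps)
    also have "\<dots> = 3/4 * s - 2/25 + 3/1250 / s + 2/10^6 * s"
      using s(1) by (simp add: field_simps power2_eq_square)
    also have "\<dots> \<le> s\<^sup>2 + 0.10713 - 1/25"
    proof -
      have "s * s \<le> 1" using s by (simp add: mult_le_one)
      \<comment> \<open>The slack between the exact cubic and its factored approximation:
        0.000011208 is 0.366^2 * 0.018 - 0.0024, the term in s comes from rounding 0.147132 to
        0.14713, and the term in s^2 from the discretization error 1/10^6.\<close>
      then have rest: "0 \<le> 0.000011208 - 0.000002 * s - 0.000002 * (s * s)"
        using s by simp
      \<comment> \<open>After multiplication by \<open>s\<close> the claim is a cubic inequality; 0.366 is an approximate double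
        root of the cubic, and 0.018 the remaining root.\<close>
      have "0 \<le> (s - 0.366)\<^sup>2 * (s - 0.018)" using s4 by simp
      also have "\<dots> \<le> (s - 0.366)\<^sup>2 * (s - 0.018) + (0.000011208 - 0.000002 * s - 0.000002 * (s * s))"
        using rest by simp
      also have "\<dots> = s * (s\<^sup>2 + 0.10713 - 1/25 - (3/4 * s - 2/25 + 3/1250 / s + 2/10^6 * s))"
        using s(1) by (simp add: field_simps power2_eq_square)
      finally show ?thesis using s(1) by (simp add: zero_le_mult_iff)
    qed
    finally show "2 * s * (\<Sum>i<n. \<mu> i * max 0 (\<bar>inner (a i) e\<bar> - 1/25 / s)) \<le> s\<^sup>2 + 0.10713 - 1/25" .
  qed (use \<mu> unit sum1 in auto)
  then have upper: "1.49339 * SDP 1 ?M < 0.16" by simp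
  \<comment> \<open>The same matrix serves every d; only the embedding of its points depends on
    d.\<close>
  have "K_G d \<ge> 1.49339" if d: "d \<ge> 5" for d
  proof (rule ccontr)
    assume "\<not> K_G d \<ge> 1.49339"
    then have "SDP d ?M \<le> 1.49339 * SDP 1 ?M"
      using K_G_le_iff[of d "1.49339"] d by simp
    moreover have "0.16 \<le> SDP d ?M"
      using SDP_davie_reeds_mat_ge[of d n a \<mu> "1/25"] d unit sum1 by simp
    ultimately show False using upper by linarith
  qed
  then show ?thesis by simp
qed

end
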